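(* For $n\geq 0$, let $Q(\mathcal{M}_n)$ be the set of projections of the Motzkin monoid $\mathcal{M}_n$ of rank at most $2$. Then $$|Q(\mathcal{M}_n)|=M(n+2)-M(n+1),$$ where $M(m)$ denotes the $m$th Motzkin number.
   Context: For an integer $n\ge 0$ let $\mathbf n=\{1,\dots,n\}$ and $\mathbf n'=\{1',\dots,n'\}$. The partition monoid $\mathcal P_n$ is the set of all set partitions of $\mathbf n\cup\mathbf n'$. Product of $\alpha,\beta\in\mathcal P_n$: with $\mathbf n''=\{1'',\dots,n''\}$, rename each $x'$ in $\alpha$ as $x''$ and each (unprimed) $x$ in $\beta$ as $x''$; consider the equivalence on $\mathbf n\cup\mathbf n''\cup\mathbf n'$ generated by the blocks of these two renamed partitions; $x,y\in\mathbf n\cup\mathbf n'$ are in the same block of $\alpha\beta$ iff they are related by this equivalence. $\alpha^*$ is obtained from $\alpha$ by interchanging $x$ and $x'$ for all $x$. The rank of $\alpha$ is the number of its blocks meeting both $\mathbf n$ and $\mathbf n'$. A projection is an element $\varepsilon$ with $\varepsilon^2=\varepsilon=\varepsilon^*$. $\alpha$ is planar if it can be drawn by a graph, whose connected components are the blocks, with vertices $1,\dots,n$ in order on an upper row and $1',\dots,n'$ in order on a lower row, with all edges inside the rectangle spanned by the vertices and with no crossings (equivalently, $\alpha$ is a non-crossing partition for the cyclic order $1,\dots,n,n',\dots,1'$). $\mathcal{M}_n$ is the submonoid of $\mathcal P_n$ of all planar partitions all of whose blocks have size at most $2$. The Motzkin number $M(m)$ is the number of non-crossing partitions of $\{1,\dots,m\}$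 with all blocks of size at most $2$ ($M(0)=M(1)=1$, $M(2)=2$, $M(3)=4$, $M(4)=9,\dots$). *)

theory Defs
  imports Main "HOL-Library.Disjoint_Sets"
begin

text \<open>
  \<open>Top i\<close>, \<open>Bot i\<close> and \<open>Mid i\<close> stand for \<open>i\<close>, \<open>i'\<close> and \<open>i''\<close>. The middle row is only used
  while forming a product.
\<close>

datatype vertex = Top nat | Mid nat | Bot nat

definition verts :: "nat \<Rightarrow> vertex set" where
  "verts n = Top ` {1..n} \<union> Bot ` {1..n}"

type_synonym diagram = "vertex set set"

definition partition_monoid :: "nat \<Rightarrow> diagram set" where
  "partition_monoid n = {\<alpha>. partition_on (verts n) \<alpha>}"


subsection \<open>Product and involution\<close>

fun bot_to_mid :: "vertex \<Rightarrow> vertex" where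
  "bot_to_mid (Bot i) = Mid i"
| "bot_to_mid v = v"

fun top_to_mid :: "vertex \<Rightarrow> vertex" where
  "top_to_mid (Top i) = Mid i"
| "top_to_mid v = v"

fun swap_rows :: "vertex \<Rightarrow> vertex" where
  "swap_rows (Top i) = Bot i"
| "swap_rows (Bot i) = Top i"
| "swap_rows (Mid i) = Mid i"

definition same_block :: "'a set set \<Rightarrow> ('a \<times> 'a) set" where
  "same_block P = (\<Union>A\<in>P. A \<times> A)"

text \<open>
  Since \<^term>\<open>same_block P\<close> is symmetric, the reflexive transitive closure is the equivalence
  generated by the blocks.
\<close>

definition glued :: "diagram \<Rightarrow> diagram \<Rightarrow> (vertex \<times> vertex) set" where
  "glued \<alpha> \<beta> = (same_block ((`) bot_to_mid ` \<alpha>) \<union> same_block ((`) top_to_mid ` \<beta>))\<^sup>*"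

definition diagram_mult :: "nat \<Rightarrow> diagram \<Rightarrow> diagram \<Rightarrow> diagram" where
  "diagram_mult n \<alpha> \<beta> = verts n // (glued \<alpha> \<beta> \<inter> verts n \<times> verts n)"

definition diagram_star :: "diagram \<Rightarrow> diagram" where
  "diagram_star \<alpha> = (`) swap_rows ` \<alpha>"

definition diagram_rank :: "diagram \<Rightarrow> nat" where
  "diagram_rank \<alpha> = card {A \<in> \<alpha>. A \<inter> range Top \<noteq> {} \<and> A \<inter> range Bot \<noteq> {}}"


subsection \<open>Non-crossing partitions\<close>

text \<open>
  \<^term>\<open>pos\<close> lists the points along a line. Being non-crossing is invariant under cyclic rotation
  of this listing, so a cyclic order may be cut open at any place.
\<close>

definition noncrossing :: "('a \<Rightarrow> nat) \<Rightarrow> 'a set set \<Rightarrow> bool" where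
  "noncrossing pos P \<longleftrightarrow>
     \<not> (\<exists>A\<in>P. \<exists>B\<in>P. A \<noteq> B \<and>
          (\<exists>a\<in>A. \<exists>b\<in>B. \<exists>c\<in>A. \<exists>d\<in>B. pos a < pos b \<and> pos b < pos c \<and> pos c < pos d))"

text \<open>
  The positions of \<open>1, \<dots>, n, n', \<dots>, 1'\<close> on the boundary of the rectangle. The value at the
  middle row is irrelevant.
\<close>

fun boundary_pos :: "nat \<Rightarrow> vertex \<Rightarrow> nat" where
  "boundary_pos n (Top i) = i"
| "boundary_pos n (Bot i) = 2 * n + 1 - i"
| "boundary_pos n (Mid i) = 0"

definition planar :: "nat \<Rightarrow> diagram \<Rightarrow> bool" where
  "planar n \<alpha> \<longleftrightarrow> noncrossing (boundary_pos n) \<alpha>"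


subsection \<open>The Motzkin monoid and the Motzkin numbers\<close>

definition motzkin_monoid :: "nat \<Rightarrow> diagram set" where
  "motzkin_monoid n = {\<alpha> \<in> partition_monoid n. planar n \<alpha> \<and> (\<forall>A\<in>\<alpha>. card A \<le> 2)}"

definition is_projection :: "nat \<Rightarrow> diagram \<Rightarrow> bool" where
  "is_projection n \<epsilon> \<longleftrightarrow> diagram_mult n \<epsilon> \<epsilon> = \<epsilon> \<and> diagram_star \<epsilon> = \<epsilon>"

definition Q_motzkin :: "nat \<Rightarrow> diagram set" where
  "Q_motzkin n = {\<epsilon> \<in> motzkin_monoid n. is_projection n \<epsilon> \<and> diagram_rank \<epsilon> \<le> 2}"

definition motzkin :: "nat \<Rightarrow> nat" where
  "motzkin m = card {P. partition_on {1..m} P \<and> noncrossing id P \<and> (\<forall>A\<in>P. card A \<le> 2)}"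

end

theory Submission
  imports Defs
begin

text \<open>
  In a planar diagram that is fixed by the involution and has blocks of size at most 2, every
  transversal block is vertical, so the diagram is determined by its upper row: a non-crossing
  partial matching in which no transversal point lies below an arc. Conversely each such upper row
  gives a projection. Let \<open>a(n, r)\<close> count the upper rows on \<open>n\<close> points with \<open>r\<close> transversal points.
  The last point is transversal, a singleton, or joined to the last transversal point
  among the others, whence \<open>a(n+1, r) = a(n, r-1) + a(n, r) + a(n, r+1)\<close>. Since \<open>M(n) = a(n, 0)\<close>,
  we get \<open>M(n+2) - M(n+1) = a(n+1, 1) = a(n, 0) + a(n, 1) + a(n, 2)\<close>.
\<close>

section \<open>Upper rows: matchings with uncovered points\<close>

text \<open>The points not covered by \<^term>\<open>P\<close> represent the transversals.\<close>

definition open_matchings :: "nat \<Rightarrow> nat \<Rightarrow> nat set set set" where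
  "open_matchings n r = {P. partition_on (\<Union>P) P \<and> \<Union>P \<subseteq> {1..n} \<and> noncrossing id P \<and>
     (\<forall>A\<in>P. card A \<le> 2) \<and> (\<forall>A\<in>P. \<forall>a\<in>A. \<forall>c\<in>A. {a<..<c} \<subseteq> \<Union>P) \<and>
     card ({1..n} - \<Union>P) = r}"

lemma noncrossingI:
  assumes "\<And>A B a b c d. \<lbrakk>A \<in> P; B \<in> P; a \<in> A; b \<in> B; c \<in> A; d \<in> B;
    pos a < pos b; pos b < pos c; pos c < pos d\<rbrakk> \<Longrightarrow> A = B"
  shows "noncrossing pos P"
  using assms unfolding noncrossing_def by metis

lemma noncrossingD:
  assumes "noncrossing pos P" "A \<in> P" "B \<in> P" "a \<in> A" "b \<in> B" "c \<in> A" "d \<in> B"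
    "pos a < pos b" "pos b < pos c" "pos c < pos d"
  shows "A = B"
  using assms unfolding noncrossing_def by metis

lemma noncrossing_subset:
  assumes "noncrossing pos P" "Q \<subseteq> P"
  shows "noncrossing pos Q"
proof (rule noncrossingI)
  fix A B a b c d
  assume *: "A \<in> Q" "B \<in> Q" "a \<in> A" "b \<in> B" "c \<in> A" "d \<in> B"
    "pos a < pos b" "pos b < pos c" "pos c < pos d"
  then have "A \<in> P" "B \<in> P" using assms(2) by blast+
  then show "A = B" using * by (intro noncrossingD[OF assms(1)])
qed

text \<open>With the ground set taken to be \<open>\<Union>P\<close> itself, being a partition
  reduces to nonempty, pairwise disjoint blocks. This blockwise form lets membership be proved one
  condition at a time.\<close>

lemma open_matchings_iff:
  "P \<in> open_matchings n r \<longleftrightarrow> {} \<notin> P \<and> (\<forall>A\<in>P. \<forall>B\<in>P. A \<noteq> B \<longrightarrow> A \<inter> B = {}) \<and>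
     (\<forall>A\<in>P. A \<subseteq> {1..n} \<and> card A \<le> 2) \<and> noncrossing id P \<and>
     (\<forall>A\<in>P. \<forall>a\<in>A. \<forall>c\<in>A. {a<..<c} \<subseteq> \<Union>P) \<and> card ({1..n} - \<Union>P) = r"
  unfolding open_matchings_def partition_on_def disjoint_def mem_Collect_eq ball_conj_distrib
    Sup_le_iff
  by argo

lemma finite_open_matchings: "finite (open_matchings n r)"
  by (rule finite_subset[of _ "Pow (Pow {1..n})"]) (auto simp: open_matchings_def)

lemma open_matchingsD:
  assumes "P \<in> open_matchings n r"
  shows "{} \<notin> P" "\<And>A B x. A \<in> P \<Longrightarrow> B \<in> P \<Longrightarrow> x \<in> A \<Longrightarrow> x \<in> B \<Longrightarrow> A = B"
    "\<And>A. A \<in> P \<Longrightarrow> A \<subseteq> {1..n}" "\<And>A. A \<in> P \<Longrightarrow> card A \<le> 2" "noncrossing id P"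
    "\<And>A a c. A \<in> P \<Longrightarrow> a \<in> A \<Longrightarrow> c \<in> A \<Longrightarrow> {a<..<c} \<subseteq> \<Union>P"
    "card ({1..n} - \<Union>P) = r"
proof -
  have *: "{} \<notin> P" "\<forall>A\<in>P. \<forall>B\<in>P. A \<noteq> B \<longrightarrow> A \<inter> B = {}"
    "\<forall>A\<in>P. A \<subseteq> {1..n} \<and> card A \<le> 2" "noncrossing id P"
    "\<forall>A\<in>P. \<forall>a\<in>A. \<forall>c\<in>A. {a<..<c} \<subseteq> \<Union>P" "card ({1..n} - \<Union>P) = r"
    using assms[unfolded open_matchings_iff] by argo+
  show "{} \<notin> P" "noncrossing id P" "card ({1..n} - \<Union>P) = r" by fact+
  show "A = B" if "A \<in> P" "B \<in> P" "x \<in> A" "x \<in> B" for A B x using *(2) that by blast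
  show "A \<subseteq> {1..n}" if "A \<in> P" for A using *(3) that by blast
  show "card A \<le> 2" if "A \<in> P" for A using *(3) that by blast
  show "{a<..<c} \<subseteq> \<Union>P" if "A \<in> P" "a \<in> A" "c \<in> A" for A a c using *(5) that by blast
qed

text \<open>For \<open>r = 0\<close> the cardinality condition forces
  \<open>\<Union>P = {1..m}\<close>. Every point is then covered, so the condition on points below
  arcs holds automatically.\<close>

lemma motzkin_eq_card_open_matchings: "motzkin m = card (open_matchings m 0)"
proof -
  have "partition_on {1..m} P \<and> noncrossing id P \<and> (\<forall>A\<in>P. card A \<le> 2) \<longleftrightarrow> P \<in> open_matchings m 0"
    for P
  proof (cases "\<Union>P = {1..m}")
    case True
    have "{a<..<c} \<subseteq> \<Union>P" if "A \<in> P" "a \<in> A" "c \<in> A" for A a c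
    proof -
      have "a \<in> {1..m}" "c \<in> {1..m}" using that True by blast+
      then show ?thesis unfolding True by auto
    qed
    then show ?thesis using True unfolding open_matchings_def by simp
  next
    case False
    then show ?thesis unfolding open_matchings_def partition_on_def by auto
  qed
  then show ?thesis unfolding motzkin_def by simp
qed

section \<open>The three-term recurrence, by the role of the last point\<close>

lemma subset_atLeastAtMost_Suc:
  assumes "A \<subseteq> {1..Suc n}" "Suc n \<notin> A"
  shows "A \<subseteq> {1..n}"
proof
  fix x assume "x \<in> A"
  then have "x \<in> {1..Suc n}" "x \<noteq> Suc n" using assms by blast+
  then show "x \<in> {1..n}" by simp
qed

lemma card_le_2_eq_pair:
  assumes "card A \<le> 2" "finite A" "x \<in> A" "y \<in> A" "x \<noteq> y"
  shows "A = {x, y}"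
proof -
  have "{x, y} \<subseteq> A" "card A \<le> card {x, y}" using assms by simp_all
  then show ?thesis using card_seteq[OF assms(2)] by metis
qed

text \<open>The same set of blocks is viewed on \<open>n\<close> and on \<open>Suc n\<close> points.
  The last point lies below no arc, so only the number of uncovered points changes, by one; hence
  nothing is possible for \<open>r = 0\<close>.\<close>

lemma open_matchings_last_uncovered:
  "{P \<in> open_matchings (Suc n) r. Suc n \<notin> \<Union>P} = (case r of 0 \<Rightarrow> {} | Suc k \<Rightarrow> open_matchings n k)"
proof -
  have "P \<in> open_matchings (Suc n) r \<and> Suc n \<notin> \<Union>P
      \<longleftrightarrow> (\<exists>k. r = Suc k \<and> P \<in> open_matchings n k)" for P
  proof (cases "\<Union>P \<subseteq> {1..n}")
    case True
    then have "Suc n \<notin> \<Union>P" by (metis atLeastAtMost_iff lessI linorder_not_less subsetD)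
    then have "{1..Suc n} - \<Union>P = insert (Suc n) ({1..n} - \<Union>P)" by auto
    then have "card ({1..Suc n} - \<Union>P) = Suc (card ({1..n} - \<Union>P))" by simp
    moreover have "(\<Union>P \<subseteq> {1..Suc n}) = (\<Union>P \<subseteq> {1..n})" using True by auto
    ultimately show ?thesis using \<open>Suc n \<notin> \<Union>P\<close> unfolding open_matchings_def by auto
  next
    case False
    then show ?thesis
      using subset_atLeastAtMost_Suc[of "\<Union>P" n] unfolding open_matchings_def by blast
  qed
  then show ?thesis by (auto split: nat.split)
qed

text \<open>An isolated last point takes part in no crossing and lies below no arc, so adding or
  deleting it leaves the uncovered points as they are.\<close>

lemma open_matchings_last_singleton:
  "{P \<in> open_matchings (Suc n) r. {Suc n} \<in> P} = insert {Suc n} ` open_matchings n r"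
proof (intro equalityI subsetI)
  fix P assume "P \<in> {P \<in> open_matchings (Suc n) r. {Suc n} \<in> P}"
  then have P: "P \<in> open_matchings (Suc n) r" and last: "{Suc n} \<in> P" by auto
  let ?P = "P - {{Suc n}}"
  have sub: "A \<subseteq> {1..n}" if "A \<in> ?P" for A
  proof -
    have "A \<subseteq> {1..Suc n}" "Suc n \<notin> A"
      using open_matchingsD(2,3)[OF P] last that by blast+
    then show ?thesis by (rule subset_atLeastAtMost_Suc)
  qed
  have un: "\<Union>P = insert (Suc n) (\<Union>?P)" using last by blast
  have "?P \<in> open_matchings n r"
    unfolding open_matchings_iff
  proof (intro conjI ballI impI)
    fix A a c assume A: "A \<in> ?P" "a \<in> A" "c \<in> A"
    then have "{a<..<c} \<subseteq> \<Union>P" using open_matchingsD(6)[OF P] by blast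
    moreover have "c \<le> n" using sub[OF A(1)] A(3) by auto
    ultimately show "{a<..<c} \<subseteq> \<Union>?P" unfolding un by auto
  next
    have "{1..Suc n} - \<Union>P = {1..n} - \<Union>?P" unfolding un by auto
    then show "card ({1..n} - \<Union>?P) = r" using open_matchingsD(7)[OF P] by simp
  next
    show "noncrossing id ?P" using open_matchingsD(5)[OF P] by (rule noncrossing_subset) blast
  next
    fix B C assume "B \<in> ?P" "C \<in> ?P" "B \<noteq> C"
    then show "B \<inter> C = {}" using open_matchingsD(2)[OF P, of B C] by blast
  next
    show "{} \<notin> ?P" using open_matchingsD(1)[OF P] by blast
  next
    fix B assume "B \<in> ?P"
    then show "B \<subseteq> {1..n}" "card B \<le> 2" using sub open_matchingsD(4)[OF P] by blast+
  qed
  moreover have "P = insert {Suc n} ?P" using last by blast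
  ultimately show "P \<in> insert {Suc n} ` open_matchings n r" by blast
next
  fix P assume "P \<in> insert {Suc n} ` open_matchings n r"
  then obtain P' where P': "P' \<in> open_matchings n r" and P: "P = insert {Suc n} P'" by blast
  have sub: "A \<subseteq> {1..n}" if "A \<in> P'" for A using open_matchingsD(3)[OF P'] that .
  have notin: "Suc n \<notin> A" if "A \<in> P'" for A using sub[OF that] by auto
  have "P \<in> open_matchings (Suc n) r"
    unfolding open_matchings_iff
  proof (intro conjI)
    show "noncrossing id P"
    proof (rule noncrossingI)
      fix A B a b c d
      assume *: "A \<in> P" "B \<in> P" "a \<in> A" "b \<in> B" "c \<in> A" "d \<in> B"
        "id a < id b" "id b < id c" "id c < id d"
      \<comment> \<open>In a crossing each block has two distinct points, so neither block is the
        new singleton.\<close>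
      then have "A \<noteq> {Suc n}" "B \<noteq> {Suc n}" by auto
      then have "A \<in> P'" "B \<in> P'" using *(1,2) unfolding P by simp_all
      then show "A = B" using * by (intro noncrossingD[OF open_matchingsD(5)[OF P']])
    qed
    have "{a<..<c} \<subseteq> \<Union>P" if "A \<in> P" "a \<in> A" "c \<in> A" for A a c
    proof (cases "A = {Suc n}")
      case False
      then show ?thesis using open_matchingsD(6)[OF P', of A a c] that unfolding P by auto
    qed (use that in auto)
    then show "\<forall>A\<in>P. \<forall>a\<in>A. \<forall>c\<in>A. {a<..<c} \<subseteq> \<Union>P" by blast
    have "A \<subseteq> {1..Suc n} \<and> card A \<le> 2" if "A \<in> P" for A
      using that open_matchingsD(4)[OF P'] sub[of A] unfolding P by force
    then show "\<forall>A\<in>P. A \<subseteq> {1..Suc n} \<and> card A \<le> 2" by blast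
    show "\<forall>A\<in>P. \<forall>B\<in>P. A \<noteq> B \<longrightarrow> A \<inter> B = {}"
      using open_matchingsD(2)[OF P'] notin unfolding P by blast
    have "{1..Suc n} - \<Union>P = {1..n} - \<Union>P'" unfolding P by auto
    then show "card ({1..Suc n} - \<Union>P) = r" using open_matchingsD(7)[OF P'] by simp
  qed (use open_matchingsD(1)[OF P'] in \<open>auto simp: P\<close>)
  then show "P \<in> {P \<in> open_matchings (Suc n) r. {Suc n} \<in> P}" using P by blast
qed

text \<open>The partner of the last point is forced: any smaller uncovered point would leave a
  larger one uncovered below the new arc. The \<open>Max\<close> is meaningful only if some point is
  uncovered, and the map is applied only in that case.\<close>

definition close_last :: "nat \<Rightarrow> nat set set \<Rightarrow> nat set set" where
  "close_last n P = insert {Max ({1..n} - \<Union>P), Suc n} P"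

text \<open>Deleting the arc that ends at \<open>Suc n\<close> uncovers its other end
  \<open>i\<close>. All points strictly between were covered, so \<open>i\<close> becomes the
  largest uncovered point and \<open>close_last\<close> restores the arc. Conversely, an uncovered
  point lies below no arc, so the arc added by \<open>close_last\<close> crosses nothing.\<close>

lemma open_matchings_last_paired:
  "{P \<in> open_matchings (Suc n) r. Suc n \<in> \<Union>P \<and> {Suc n} \<notin> P}
     = close_last n ` open_matchings n (Suc r)"
proof (intro equalityI subsetI)
  fix P assume "P \<in> {P \<in> open_matchings (Suc n) r. Suc n \<in> \<Union>P \<and> {Suc n} \<notin> P}"
  then obtain A where P: "P \<in> open_matchings (Suc n) r" and A: "A \<in> P" "Suc n \<in> A"
    and "A \<noteq> {Suc n}" by blast
  then obtain i where i: "i \<in> A" "i \<noteq> Suc n" by blast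
  note ne = open_matchingsD(1)[OF P] and disj = open_matchingsD(2)[OF P]
    and sub' = open_matchingsD(3)[OF P] and le2 = open_matchingsD(4)[OF P]
    and nc = open_matchingsD(5)[OF P] and exposed = open_matchingsD(6)[OF P]
    and card = open_matchingsD(7)[OF P]
  have "finite A" using sub'[OF A(1)] by (rule finite_subset) simp
  then have Aeq: "A = {i, Suc n}" using card_le_2_eq_pair[OF le2[OF A(1)]] i A(2) by blast
  have i_le: "1 \<le> i" "i \<le> n" using sub'[OF A(1)] i by auto
  let ?P = "P - {A}"
  have disjA: "B \<inter> A = {}" if "B \<in> ?P" for B using disj A(1) that by blast
  have sub: "B \<subseteq> {1..n}" if "B \<in> ?P" for B
    using disjA[OF that] sub'[of B] that A(2) subset_atLeastAtMost_Suc by blast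
  have un: "\<Union>?P = \<Union>P - A" using disjA A(1) by blast
  have T: "{1..n} - \<Union>?P = insert i ({1..Suc n} - \<Union>P)"
    unfolding un using i_le A(1) Aeq by (auto simp: le_Suc_eq)
  \<comment> \<open>A larger point of \<open>{1..n}\<close> lies below the arc \<open>A\<close>, so
    \<open>P\<close> covers it, and it is not an end of \<open>A\<close>; it therefore stays covered
    after \<open>A\<close> is removed.\<close>
  have Max: "Max ({1..n} - \<Union>?P) = i"
  proof (rule Max_eqI)
    fix t assume t: "t \<in> {1..n} - \<Union>?P"
    show "t \<le> i"
    proof (rule ccontr)
      assume "\<not> t \<le> i"
      then have "t \<in> {i<..<Suc n}" using t by auto
      then have "t \<in> \<Union>P" using exposed[OF A(1) i(1) A(2)] by blast
      then have "t \<in> A" using t un by blast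
      then show False using \<open>t \<in> {i<..<Suc n}\<close> Aeq by auto
    qed
  qed (use T in auto)
  have "?P \<in> open_matchings n (Suc r)"
    unfolding open_matchings_iff
  proof (intro conjI ballI impI)
    fix B a c assume B: "B \<in> ?P" "a \<in> B" "c \<in> B"
    have "c < Suc n" using sub[OF B(1)] B(3) by auto
    \<comment> \<open>Removing \<open>A\<close> uncovers nothing below a remaining block: since
      \<open>A\<close> also contains \<open>Suc n\<close>, which lies to the right of
      \<open>c\<close>, a point of \<open>A\<close> between \<open>a\<close> and \<open>c\<close>
      would make \<open>B\<close> and \<open>A\<close> cross.\<close>
    have "x \<notin> A" if x: "x \<in> {a<..<c}" for x
    proof
      assume "x \<in> A"
      then have "B = A"
        by (intro noncrossingD[OF nc _ A(1) B(2) _ B(3) A(2)]) (use B(1) x \<open>c < Suc n\<close> in auto)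
      then show False using B by blast
    qed
    then show "{a<..<c} \<subseteq> \<Union>?P" unfolding un using exposed B by blast
  next
    have "i \<notin> {1..Suc n} - \<Union>P" using i A by blast
    then show "card ({1..n} - \<Union>?P) = Suc r" unfolding T using card by simp
  next
    show "noncrossing id ?P" using nc by (rule noncrossing_subset) blast
  next
    fix B C assume "B \<in> ?P" "C \<in> ?P" "B \<noteq> C"
    then show "B \<inter> C = {}" using disj[of B C] by blast
  next
    show "{} \<notin> ?P" using ne by blast
  next
    fix B assume "B \<in> ?P"
    then show "B \<subseteq> {1..n}" "card B \<le> 2" using sub le2 by blast+
  qed
  moreover have "P = close_last n ?P" unfolding close_last_def Max using A Aeq by blast
  ultimately show "P \<in> close_last n ` open_matchings n (Suc r)" by blast
next
  fix P assume "P \<in> close_last n ` open_matchings n (Suc r)"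
  then obtain P' where P': "P' \<in> open_matchings n (Suc r)" and "P = close_last n P'" by blast
  let ?T = "{1..n} - \<Union>P'"
  define i where "i = Max ?T"
  have P: "P = insert {i, Suc n} P'" using \<open>P = close_last n P'\<close> by (simp add: close_last_def i_def)
  note ne = open_matchingsD(1)[OF P'] and disj = open_matchingsD(2)[OF P']
    and sub = open_matchingsD(3)[OF P'] and le2 = open_matchingsD(4)[OF P']
    and nc = open_matchingsD(5)[OF P'] and exposed = open_matchingsD(6)[OF P']
    and card = open_matchingsD(7)[OF P']
  \<comment> \<open>The count \<open>Suc r\<close> of uncovered points guarantees that the maximum
    is taken over a nonempty set.\<close>
  have "?T \<noteq> {}" using card by (metis card.empty nat.distinct(1))
  then have i: "i \<in> ?T" unfolding i_def by (intro Max_in) auto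
  have above: "x \<in> \<Union>P'" if "i < x" "x \<le> n" for x
  proof (rule ccontr)
    assume "x \<notin> \<Union>P'"
    then have "x \<in> ?T" using that by auto
    then have "x \<le> i" unfolding i_def by (intro Max_ge) auto
    then show False using that by simp
  qed
  have bound: "x \<le> n" if "x \<in> A" "A \<in> P'" for x A using sub[OF that(2)] that(1) by auto
  have notin: "Suc n \<notin> A" "i \<notin> A" if "A \<in> P'" for A using bound[OF _ that, of "Suc n"] that i by auto
  have inew: "\<not> (a < i \<and> i < c)" if "A \<in> P'" "a \<in> A" "c \<in> A" for A a c
    using exposed[OF that] i by auto
  have "P \<in> open_matchings (Suc n) r"
    unfolding open_matchings_iff
  proof (intro conjI)
    show "{} \<notin> P" using ne P by auto
    have "A \<inter> {i, Suc n} = {}" if "A \<in> P'" for A using notin[OF that] by simp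
    moreover have "A \<inter> B = {}" if "A \<in> P'" "B \<in> P'" "A \<noteq> B" for A B
      using disj[OF that(1,2)] that(3) by blast
    ultimately show "\<forall>A\<in>P. \<forall>B\<in>P. A \<noteq> B \<longrightarrow> A \<inter> B = {}"
      unfolding P by (simp add: Int_commute)
    have "A \<subseteq> {1..Suc n} \<and> card A \<le> 2" if "A \<in> P" for A
      using that le2[of A] sub[of A] i unfolding P by (force simp: card_insert_if)
    then show "\<forall>A\<in>P. A \<subseteq> {1..Suc n} \<and> card A \<le> 2" by blast
    show "noncrossing id P"
    proof (rule noncrossingI)
      fix A B a b c d
      assume *: "A \<in> P" "B \<in> P" "a \<in> A" "b \<in> B" "c \<in> A" "d \<in> B"
        "id a < id b" "id b < id c" "id c < id d"
      \<comment> \<open>Nothing lies to the right of \<open>Suc n\<close>, so the new arc cannot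
        start first in a crossing. If it starts second, then \<open>i\<close> lies strictly between
        two points of a block of \<open>P'\<close>, against \<open>inew\<close>.\<close>
      consider "A \<in> P'" "B \<in> P'" | "A = {i, Suc n}" "B \<in> P'" | "A \<in> P'" "B = {i, Suc n}"
        | "A = B" using *(1,2) unfolding P by blast
      then show "A = B"
      proof cases
        case 1 then show ?thesis using * by (intro noncrossingD[OF nc])
      next
        case 2
        then have "c \<le> Suc n" "a = i \<or> a = Suc n" "c = i \<or> c = Suc n" "d \<le> n"
          using *(3-6) bound[of d B] i by auto
        then show ?thesis using *(7-9) i by auto
      next
        case 3
        then have "b = i \<or> b = Suc n" "c \<le> n" "\<not> (a < i \<and> i < c)"
          using *(3-6) bound[of c A] inew[of A a c] by auto
        then show ?thesis using *(7,8) by auto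
      qed
    qed
    show "\<forall>A\<in>P. \<forall>a\<in>A. \<forall>c\<in>A. {a<..<c} \<subseteq> \<Union>P"
    proof (intro ballI)
      fix A a c assume *: "A \<in> P" "a \<in> A" "c \<in> A"
      show "{a<..<c} \<subseteq> \<Union>P"
      proof (cases "A \<in> P'")
        case True then show ?thesis using exposed[OF True *(2,3)] P by blast
      next
        case False
        then have "A = {i, Suc n}" using *(1) P by simp
        then have "a = i \<or> a = Suc n" "c = i \<or> c = Suc n" using *(2,3) by simp_all
        then have "{a<..<c} \<subseteq> {i<..n}" using i by auto
        moreover have "{i<..n} \<subseteq> \<Union>P'" using above by auto
        ultimately show ?thesis unfolding P by blast
      qed
    qed
    have "{1..Suc n} - \<Union>P = ?T - {i}" unfolding P by auto
    then show "card ({1..Suc n} - \<Union>P) = r" using card i by simp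
  qed
  moreover have "{Suc n} \<notin> P" using notin i P by auto
  ultimately show "P \<in> {P \<in> open_matchings (Suc n) r. Suc n \<in> \<Union>P \<and> {Suc n} \<notin> P}"
    using P by blast
qed

lemma card_open_matchings_Suc:
  "card (open_matchings (Suc n) r) = (case r of 0 \<Rightarrow> 0 | Suc k \<Rightarrow> card (open_matchings n k))
     + card (open_matchings n r) + card (open_matchings n (Suc r))"
proof -
  let ?S = "open_matchings (Suc n) r"
  let ?X = "{P \<in> ?S. Suc n \<notin> \<Union>P}" and ?Y = "{P \<in> ?S. {Suc n} \<in> P}"
    and ?Z = "{P \<in> ?S. Suc n \<in> \<Union>P \<and> {Suc n} \<notin> P}"
  have fin: "finite ?X" "finite ?Y" "finite ?Z" using finite_open_matchings by auto
  have "?S = (?X \<union> ?Y) \<union> ?Z" by blast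
  then have "card ?S = card ((?X \<union> ?Y) \<union> ?Z)" by simp
  also have "\<dots> = card (?X \<union> ?Y) + card ?Z" using fin by (intro card_Un_disjoint) auto
  also have "card (?X \<union> ?Y) = card ?X + card ?Y" using fin by (intro card_Un_disjoint) auto
  also have "card ?X = (case r of 0 \<Rightarrow> 0 | Suc k \<Rightarrow> card (open_matchings n k))"
    unfolding open_matchings_last_uncovered by (simp split: nat.split)
  finally have split: "card ?S = (case r of 0 \<Rightarrow> 0 | Suc k \<Rightarrow> card (open_matchings n k))
      + card ?Y + card ?Z" .
  have notin: "Suc n \<notin> \<Union>P" if "P \<in> open_matchings n k" for P k
    using that unfolding open_matchings_def by auto
  \<comment> \<open>Discarding the blocks through \<open>Suc n\<close> is a common left inverse of
    both insertions, which gives their injectivity.\<close>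
  have drop: "{A \<in> insert B P. Suc n \<notin> A} = P"
    if "P \<in> open_matchings n k" "Suc n \<in> B" for P k B
    using notin[OF that(1)] that(2) by blast
  have "inj_on (insert {Suc n}) (open_matchings n r)"
    by (rule inj_on_inverseI[where g = "\<lambda>P. {A \<in> P. Suc n \<notin> A}"]) (simp only: drop insertI1)
  then have Y: "card ?Y = card (open_matchings n r)"
    unfolding open_matchings_last_singleton by (rule card_image)
  have "inj_on (close_last n) (open_matchings n (Suc r))"
    unfolding close_last_def
    by (rule inj_on_inverseI[where g = "\<lambda>P. {A \<in> P. Suc n \<notin> A}"])
      (simp only: drop insertI1 insertI2)
  then have Z: "card ?Z = card (open_matchings n (Suc r))"
    unfolding open_matchings_last_paired by (rule card_image)
  show ?thesis unfolding split Y Z ..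
qed

section \<open>Upper rows give projections\<close>

definition symmetric_diagram :: "nat \<Rightarrow> nat set set \<Rightarrow> diagram" where
  "symmetric_diagram n P = (`) Top ` P \<union> (`) Bot ` P \<union> (\<lambda>t. {Top t, Bot t}) ` ({1..n} - \<Union>P)"

text \<open>Inverse construction to \<open>symmetric_diagram\<close>. Transversals and lower blocks
  may be forgotten: in the diagrams of interest the former are vertical over the uncovered points
  and the latter mirror the upper blocks.\<close>

definition top_blocks :: "diagram \<Rightarrow> nat set set" where
  "top_blocks \<alpha> = {A. Top ` A \<in> \<alpha>}"

lemma top_blocks_symmetric_diagram:
  assumes "{} \<notin> P"
  shows "top_blocks (symmetric_diagram n P) = P"
proof -
  have "inj Top" by (auto intro: injI)
  then have [simp]: "Top ` A = Top ` B \<longleftrightarrow> A = B" for A B by (rule inj_image_eq_iff)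
  have [simp]: "Top ` A = Bot ` B \<longleftrightarrow> A = {} \<and> B = {}" for A B by auto
  have [simp]: "Top ` A \<noteq> {Top t, Bot t}" for A t by (auto simp: set_eq_iff)
  show ?thesis unfolding top_blocks_def symmetric_diagram_def using assms by auto
qed

lemma symmetric_diagram_cases:
  assumes "B \<in> symmetric_diagram n P"
  obtains (top) A where "A \<in> P" "B = Top ` A" | (bot) A where "A \<in> P" "B = Bot ` A"
    | (transversal) t where "t \<in> {1..n}" "t \<notin> \<Union>P" "B = {Top t, Bot t}"
  using assms unfolding symmetric_diagram_def by blast

lemma symmetric_diagram_partition:
  assumes "partition_on (\<Union>P) P" "\<Union>P \<subseteq> {1..n}"
  shows "partition_on (verts n) (symmetric_diagram n P)"
proof (rule partition_onI)
  have "\<Union>(symmetric_diagram n P)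
      = Top ` (\<Union>P \<union> ({1..n} - \<Union>P)) \<union> Bot ` (\<Union>P \<union> ({1..n} - \<Union>P))"
    unfolding symmetric_diagram_def image_Un image_Union by auto
  also have "\<Union>P \<union> ({1..n} - \<Union>P) = {1..n}" using assms(2) by auto
  finally show "\<Union>(symmetric_diagram n P) = verts n" unfolding verts_def .
  have disj: "A = B" if "A \<in> P" "B \<in> P" "x \<in> A" "x \<in> B" for A B x
    using assms(1) that unfolding partition_on_def disjoint_def by blast
  fix A B assume AB: "A \<in> symmetric_diagram n P" "B \<in> symmetric_diagram n P" "A \<noteq> B"
  have "A = B" if "v \<in> A" "v \<in> B" for v
    using AB(1)
  proof (cases rule: symmetric_diagram_cases)
    case A: (top A')
    with that(1) obtain x where x: "x \<in> A'" "v = Top x" by blast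
    from AB(2) show ?thesis
    proof (cases rule: symmetric_diagram_cases)
      case (top B')
      then show ?thesis using A x that disj[of A' B' x] by auto
    qed (use A x that in auto)
  next
    case A: (bot A')
    with that(1) obtain x where x: "x \<in> A'" "v = Bot x" by blast
    from AB(2) show ?thesis
    proof (cases rule: symmetric_diagram_cases)
      case (bot B')
      then show ?thesis using A x that disj[of A' B' x] by auto
    qed (use A x that in auto)
  next
    case A: (transversal t)
    from AB(2) show ?thesis
      by (cases rule: symmetric_diagram_cases) (use A that in auto)
  qed
  then show "disjnt A B" using AB(3) unfolding disjnt_def by blast
next
  show "{} \<notin> symmetric_diagram n P"
    using assms(1) unfolding partition_on_def symmetric_diagram_def by auto
qed

text \<open>Along the boundary all upper blocks precede all lower ones, so blocks from opposite rows
  cannot alternate. Two blocks in the same row inherit non-crossing from \<open>P\<close>, with the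
  order reversed in the lower row. Vertical blocks are nested, and one of them could cross an arc
  only if its uncovered point lay below that arc.\<close>

lemma symmetric_diagram_planar:
  assumes "P \<in> open_matchings n r"
  shows "planar n (symmetric_diagram n P)"
proof -
  have sub: "1 \<le> x" "x \<le> n" if "x \<in> A" "A \<in> P" for x A
    using open_matchingsD(3)[OF assms that(2)] that(1) by auto
  have exposed: False if "A \<in> P" "a \<in> A" "c \<in> A" "a < t" "t < c" "t \<notin> \<Union>P" for A a c t
  proof -
    have "t \<in> {a<..<c}" using that by simp
    then show False using open_matchingsD(6)[OF assms that(1-3)] that(6) by blast
  qed
  have nc: "A = B" if "A \<in> P" "B \<in> P" "a \<in> A" "b \<in> B" "c \<in> A" "d \<in> B" "a < b" "b < c" "c < d"
    for A B a b c d
    using noncrossingD[OF open_matchingsD(5)[OF assms] that(1-6)] that(7-9) by simp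
  have upper: "boundary_pos n v \<le> n" if "v \<in> Top ` A" "A \<in> P" for v A
    using that(1) sub(2)[OF _ that(2)] by auto
  have lower: "n < boundary_pos n v" if "v \<in> Bot ` A" "A \<in> P" for v A
    using that(1) sub(2)[OF _ that(2)] by fastforce
  show ?thesis
    unfolding planar_def
  proof (rule noncrossingI)
    fix A B a b c d
    assume AB: "A \<in> symmetric_diagram n P" "B \<in> symmetric_diagram n P"
      and mem: "a \<in> A" "b \<in> B" "c \<in> A" "d \<in> B"
      and lt: "boundary_pos n a < boundary_pos n b" "boundary_pos n b < boundary_pos n c"
        "boundary_pos n c < boundary_pos n d"
    from AB(1) show "A = B"
    proof (cases rule: symmetric_diagram_cases)
      case A: (top A')
      from AB(2) show ?thesis
      proof (cases rule: symmetric_diagram_cases)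
        case (top B')
        obtain a' b' c' d' where e: "a = Top a'" "b = Top b'" "c = Top c'" "d = Top d'"
            "a' \<in> A'" "b' \<in> B'" "c' \<in> A'" "d' \<in> B'"
          using top A mem by auto
        then have "a' < b'" "b' < c'" "c' < d'" using lt by auto
        then have "A' = B'" using nc[of A' B' a' b' c' d'] e A top by simp
        then show ?thesis using A top by simp
      next
        case (bot B')
        have "n < boundary_pos n b" "boundary_pos n c \<le> n"
          using lower[of b B'] upper[of c A'] bot A mem by simp_all
        then show ?thesis using lt by simp
      next
        case (transversal t)
        obtain a' c' where e: "a = Top a'" "c = Top c'" "a' \<in> A'" "c' \<in> A'" using A mem by auto
        have "c' \<le> n" using sub(2) e A by blast
        then show ?thesis using transversal e mem lt exposed[of A' a' c' t] A by auto
      qed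
    next
      case A: (bot A')
      from AB(2) show ?thesis
      proof (cases rule: symmetric_diagram_cases)
        case (top B')
        have "n < boundary_pos n c" "boundary_pos n d \<le> n"
          using lower[of c A'] upper[of d B'] top A mem by simp_all
        then show ?thesis using lt by simp
      next
        case (bot B')
        obtain a' b' c' d' where e: "a = Bot a'" "b = Bot b'" "c = Bot c'" "d = Bot d'"
            "a' \<in> A'" "b' \<in> B'" "c' \<in> A'" "d' \<in> B'"
          using bot A mem by auto
        then have "d' < c'" "c' < b'" "b' < a'" using lt by auto
        then have "B' = A'" using nc[of B' A' d' c' b' a'] e A bot by simp
        then show ?thesis using A bot by simp
      next
        case (transversal t)
        have "b \<in> {Top t, Bot t}" "d \<in> {Top t, Bot t}" using mem(2,4) unfolding transversal(3) .
        then have "b = Top t" using lt(2,3) transversal(1) by auto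
        moreover have "n < boundary_pos n a" using lower[of a A'] A mem by simp
        ultimately show ?thesis using transversal(1) lt by simp
      qed
    next
      case A: (transversal s)
      have "a \<in> {Top s, Bot s}" "c \<in> {Top s, Bot s}" using mem(1,3) unfolding A(3) .
      then have ac: "a = Top s" "c = Bot s" using lt(1,2) A(1) by auto
      from AB(2) show ?thesis
      proof (cases rule: symmetric_diagram_cases)
        case (top B')
        have "boundary_pos n d \<le> n" using upper[of d B'] top mem by simp
        then show ?thesis using ac A(1) lt by simp
      next
        case (bot B')
        obtain b' d' where e: "b = Bot b'" "d = Bot d'" "b' \<in> B'" "d' \<in> B'" using bot mem by auto
        have "d' < s" "s < b'" using lt unfolding e ac by simp_all
        then show ?thesis using exposed[OF bot(1) e(4,3)] A(2) by blast
      next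
        case (transversal t)
        have "b \<in> {Top t, Bot t}" "d \<in> {Top t, Bot t}" using mem(2,4) unfolding transversal(3) .
        then have "b = Top t" "d = Bot t" using lt(2,3) ac A(1) transversal(1) by auto
        then show ?thesis using ac lt by simp
      qed
    qed
  qed
qed

lemma diagram_star_symmetric_diagram: "diagram_star (symmetric_diagram n P) = symmetric_diagram n P"
proof -
  have "(`) swap_rows ` (`) Top ` P = (`) Bot ` P" "(`) swap_rows ` (`) Bot ` P = (`) Top ` P"
    "(`) swap_rows ` (\<lambda>t. {Top t, Bot t}) ` T = (\<lambda>t. {Top t, Bot t}) ` T" for T
    by (simp_all add: image_image insert_commute)
  then show ?thesis unfolding diagram_star_def symmetric_diagram_def by (simp add: image_Un Un_commute)
qed

lemma quotient_same_block:
  assumes "partition_on V P"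
  shows "V // same_block P = P"
proof -
  have V: "V = \<Union>P" and ne: "{} \<notin> P" using assms unfolding partition_on_def by auto
  have block: "same_block P `` {x} = B" if "B \<in> P" "x \<in> B" for x B
    using assms that unfolding partition_on_def disjoint_def same_block_def by blast
  show ?thesis
  proof (intro equalityI subsetI)
    fix B assume "B \<in> V // same_block P"
    then obtain x C where "C \<in> P" "x \<in> C" "B = same_block P `` {x}"
      unfolding V by (elim quotientE) blast
    then show "B \<in> P" using block by simp
  next
    fix B assume B: "B \<in> P"
    then obtain x where x: "x \<in> B" using ne by (metis ex_in_conv)
    then have "x \<in> V" unfolding V using B by blast
    then have "same_block P `` {x} \<in> V // same_block P" by (rule quotientI)
    then show "B \<in> V // same_block P" using block[OF B x] by simp
  qed
qed

text \<open>In the middle row the lower blocks of the first factor coincide with the upper blocks of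
  the second. They form closed components there, while vertical blocks compose with vertical blocks,
  so the outer rows see the original partition again.\<close>

lemma diagram_mult_symmetric_diagram:
  assumes "partition_on (\<Union>P) P" "\<Union>P \<subseteq> {1..n}"
  shows "diagram_mult n (symmetric_diagram n P) (symmetric_diagram n P) = symmetric_diagram n P"
proof -
  let ?\<epsilon> = "symmetric_diagram n P" and ?T = "{1..n} - \<Union>P"
  let ?R = "same_block ((`) bot_to_mid ` ?\<epsilon>) \<union> same_block ((`) top_to_mid ` ?\<epsilon>)"
  note part = symmetric_diagram_partition[OF assms]
  have un: "\<Union>?\<epsilon> = verts n" using part unfolding partition_on_def by blast
  have disj: "B = C" if "B \<in> ?\<epsilon>" "C \<in> ?\<epsilon>" "v \<in> B" "v \<in> C" for B C v
    using that part unfolding partition_on_def disjoint_def by blast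
  have mid: "Mid x \<notin> B" if "B \<in> ?\<epsilon>" for x B
    using that by (cases rule: symmetric_diagram_cases) auto
  \<comment> \<open>An invariant of the connected components of the product graph that separates the blocks of
    \<open>\<epsilon>\<close>; it is empty on the middle vertices of the non-transversal components.\<close>
  define c where "c v = {B \<in> ?\<epsilon>. v \<in> B \<or> (\<exists>t\<in>?T. v = Mid t \<and> B = {Top t, Bot t})}" for v
  have c_verts: "c v = {B}" if "B \<in> ?\<epsilon>" "v \<in> B" for v B
  proof -
    have "v \<noteq> Mid x" for x using that mid by blast
    then show ?thesis using that disj unfolding c_def by blast
  qed
  have trans: "{Top t, Bot t} \<in> ?\<epsilon>" if "t \<in> ?T" for t
    using that unfolding symmetric_diagram_def by blast
  have c_mid: "c (Mid t) = {{Top t, Bot t}}" if "t \<in> ?T" for t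
    using that trans mid unfolding c_def by auto
  have c_mid': "c (Mid x) = {}" if "x \<in> \<Union>P" for x
    using that mid unfolding c_def by auto
  \<comment> \<open>In either copy a non-transversal block \<open>B\<close> lies wholly in an outer
    row, where \<open>c\<close> is \<open>{B}\<close>, or wholly in the middle row, where
    \<open>c\<close> is empty. For a transversal \<open>B\<close>, \<open>c\<close> is
    \<open>{B}\<close> on all of \<open>Top t\<close>, \<open>Mid t\<close> and
    \<open>Bot t\<close>.\<close>
  have step: "c u = c v" if uv: "(u, v) \<in> ?R" for u v
  proof -
    from uv obtain B where B: "B \<in> ?\<epsilon>"
      "u \<in> bot_to_mid ` B \<and> v \<in> bot_to_mid ` B \<or> u \<in> top_to_mid ` B \<and> v \<in> top_to_mid ` B"
      unfolding same_block_def by blast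
    from B(1) show ?thesis
    proof (cases rule: symmetric_diagram_cases)
      case (top A)
      have "c (Mid x) = {}" if "x \<in> A" for x using c_mid' that top(1) by blast
      moreover have "c (Top x) = {B}" if "x \<in> A" for x using c_verts[OF B(1)] that top(2) by simp
      ultimately show ?thesis using B(2) top(2) by auto
    next
      case (bot A)
      have "c (Mid x) = {}" if "x \<in> A" for x using c_mid' that bot(1) by blast
      moreover have "c (Bot x) = {B}" if "x \<in> A" for x using c_verts[OF B(1)] that bot(2) by simp
      ultimately show ?thesis using B(2) bot(2) by auto
    next
      case (transversal t)
      have "c (Mid t) = {B}" using c_mid[of t] transversal by simp
      moreover have "c (Top t) = {B}" "c (Bot t) = {B}"
        using c_verts[OF B(1)] transversal(3) by blast+
      moreover have "u \<in> {Top t, Mid t, Bot t}" "v \<in> {Top t, Mid t, Bot t}"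
        using B(2) unfolding transversal(3) by auto
      ultimately show ?thesis by (elim insertE emptyE) simp_all
    qed
  qed
  have const: "c u = c v" if "(u, v) \<in> ?R\<^sup>*" for u v
    using that
  proof (induction rule: rtrancl_induct)
    case (step y z)
    then show ?case using \<open>\<And>u v. (u, v) \<in> ?R \<Longrightarrow> c u = c v\<close> by metis
  qed simp
  have "glued ?\<epsilon> ?\<epsilon> \<inter> verts n \<times> verts n = same_block ?\<epsilon>"
  proof (intro equalityI subsetI)
    fix p assume "p \<in> glued ?\<epsilon> ?\<epsilon> \<inter> verts n \<times> verts n"
    then obtain u v where p: "p = (u, v)" "(u, v) \<in> ?R\<^sup>*" "u \<in> verts n" "v \<in> verts n"
      unfolding glued_def by blast
    then obtain B C where "B \<in> ?\<epsilon>" "u \<in> B" "C \<in> ?\<epsilon>" "v \<in> C" using un by blast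
    moreover from this have "B = C" using const[OF p(2)] c_verts by auto
    ultimately show "p \<in> same_block ?\<epsilon>" unfolding p same_block_def by blast
  next
    fix p assume "p \<in> same_block ?\<epsilon>"
    then obtain u v B where p: "p = (u, v)" and B: "B \<in> ?\<epsilon>" "u \<in> B" "v \<in> B"
      unfolding same_block_def by blast
    have R1: "(bot_to_mid x, bot_to_mid y) \<in> ?R" if "x \<in> B" "y \<in> B" for x y
      using that B unfolding same_block_def by blast
    have R2: "(top_to_mid x, top_to_mid y) \<in> ?R" if "x \<in> B" "y \<in> B" for x y
      using that B unfolding same_block_def by blast
    \<comment> \<open>Upper blocks survive unchanged in the first copy and lower blocks in the
      second; only a vertical block needs a path of two edges, through \<open>Mid t\<close>.\<close>
    from B(1) have "(u, v) \<in> ?R\<^sup>*"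
    proof (cases rule: symmetric_diagram_cases)
      case (top A)
      then show ?thesis using R1[OF B(2,3)] B by auto
    next
      case (bot A)
      then show ?thesis using R2[OF B(2,3)] B by auto
    next
      case (transversal t)
      have "(Top t, Mid t) \<in> ?R" "(Mid t, Top t) \<in> ?R"
        using R1[of "Top t" "Bot t"] R1[of "Bot t" "Top t"] transversal by auto
      moreover have "(Mid t, Bot t) \<in> ?R" "(Bot t, Mid t) \<in> ?R"
        using R2[of "Top t" "Bot t"] R2[of "Bot t" "Top t"] transversal by auto
      ultimately have "(Top t, Bot t) \<in> ?R\<^sup>*" "(Bot t, Top t) \<in> ?R\<^sup>*"
        by (meson converse_rtrancl_into_rtrancl r_into_rtrancl)+
      then show ?thesis using transversal B by auto
    qed
    moreover have "u \<in> verts n" "v \<in> verts n" using B un by blast+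
    ultimately show "p \<in> glued ?\<epsilon> ?\<epsilon> \<inter> verts n \<times> verts n" unfolding p glued_def by blast
  qed
  then show ?thesis unfolding diagram_mult_def using quotient_same_block[OF part] by simp
qed

lemma diagram_rank_symmetric_diagram:
  "diagram_rank (symmetric_diagram n P) = card ({1..n} - \<Union>P)"
proof -
  have "{A \<in> symmetric_diagram n P. A \<inter> range Top \<noteq> {} \<and> A \<inter> range Bot \<noteq> {}}
      = (\<lambda>t. {Top t, Bot t}) ` ({1..n} - \<Union>P)"
    unfolding symmetric_diagram_def by auto
  moreover have "inj_on (\<lambda>t. {Top t, Bot t}) ({1..n} - \<Union>P)" by (auto intro!: inj_onI)
  ultimately show ?thesis unfolding diagram_rank_def by (simp add: card_image)
qed

lemma symmetric_diagram_in_motzkin_monoid: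
  assumes "P \<in> open_matchings n r"
  shows "symmetric_diagram n P \<in> motzkin_monoid n"
proof -
  have "card B \<le> 2" if "B \<in> symmetric_diagram n P" for B
    using that
  proof (cases rule: symmetric_diagram_cases)
    case (top A)
    have "finite A" using open_matchingsD(3)[OF assms top(1)] by (rule finite_subset) simp
    then have "card B \<le> card A" unfolding top(2) by (rule card_image_le)
    then show ?thesis using open_matchingsD(4)[OF assms top(1)] by simp
  next
    case (bot A)
    have "finite A" using open_matchingsD(3)[OF assms bot(1)] by (rule finite_subset) simp
    then have "card B \<le> card A" unfolding bot(2) by (rule card_image_le)
    then show ?thesis using open_matchingsD(4)[OF assms bot(1)] by simp
  qed (simp add: card_insert_if)
  moreover have "partition_on (verts n) (symmetric_diagram n P)"
    using assms unfolding open_matchings_def by (intro symmetric_diagram_partition) simp_all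
  ultimately show ?thesis
    unfolding motzkin_monoid_def partition_monoid_def using symmetric_diagram_planar[OF assms] by blast
qed

section \<open>Diagrams fixed by the involution come from upper rows\<close>

text \<open>The involution pairs each block inside a row with its mirror image in the other row, and
  planarity makes every transversal vertical. Hence the upper blocks determine the diagram, and
  planarity against the vertical blocks is what keeps uncovered points out from below arcs.\<close>

lemma star_symmetric_motzkin_diagram:
  assumes \<epsilon>: "\<epsilon> \<in> motzkin_monoid n" and star: "diagram_star \<epsilon> = \<epsilon>"
  defines "P \<equiv> top_blocks \<epsilon>"
  shows "P \<in> open_matchings n (diagram_rank \<epsilon>)" "\<epsilon> = symmetric_diagram n P"
proof -
  have part: "partition_on (verts n) \<epsilon>" and le2: "\<And>B. B \<in> \<epsilon> \<Longrightarrow> card B \<le> 2"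
    and planar: "planar n \<epsilon>"
    using \<epsilon> unfolding motzkin_monoid_def partition_monoid_def by simp_all
  have un: "\<Union>\<epsilon> = verts n" and ne: "{} \<notin> \<epsilon>"
    using part unfolding partition_on_def by simp_all
  have disj: "B = C" if "B \<in> \<epsilon>" "C \<in> \<epsilon>" "v \<in> B" "v \<in> C" for B C v
    using part that unfolding partition_on_def disjoint_def by blast
  have nc: "A = B" if "A \<in> \<epsilon>" "B \<in> \<epsilon>" "a \<in> A" "b \<in> B" "c \<in> A" "d \<in> B"
      "boundary_pos n a < boundary_pos n b" "boundary_pos n b < boundary_pos n c"
      "boundary_pos n c < boundary_pos n d" for A B a b c d
    using noncrossingD[OF planar[unfolded planar_def]] that by blast
  have fin: "finite B" if "B \<in> \<epsilon>" for B
  proof (rule finite_subset)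
    show "B \<subseteq> verts n" using that un by blast
  qed (simp add: verts_def)
  have swap: "swap_rows ` B \<in> \<epsilon>" if "B \<in> \<epsilon>" for B
    using that star unfolding diagram_star_def by blast
  have bounds: "1 \<le> i \<and> i \<le> n" if "B \<in> \<epsilon>" "Top i \<in> B \<or> Bot i \<in> B" for B i
  proof -
    have "Top i \<in> verts n \<or> Bot i \<in> verts n" using that un by blast
    then show ?thesis unfolding verts_def by auto
  qed
  \<comment> \<open>If \<open>i \<noteq> j\<close>, then the block \<open>{i, j'}\<close> crosses its mirror image \<open>{j, i'}\<close>.\<close>
  have transversal: "i = j \<and> B = {Top i, Bot i}" if B: "B \<in> \<epsilon>" "Top i \<in> B" "Bot j \<in> B" for B i j
  proof -
    have eq: "B = {Top i, Bot j}" using card_le_2_eq_pair[OF le2 fin] B by blast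
    then have B': "{Bot i, Top j} \<in> \<epsilon>" using swap[OF B(1)] by simp
    have "i \<le> n" "j \<le> n" using bounds B by blast+
    have "i = j"
    proof (rule ccontr)
      assume "i \<noteq> j"
      then consider "i < j" | "j < i" by linarith
      then have "B = {Bot i, Top j}"
      proof cases
        case 1
        then show ?thesis
          using nc[OF B(1) B', of "Top i" "Top j" "Bot j" "Bot i"] B \<open>j \<le> n\<close> by auto
      next
        case 2
        then show ?thesis
          using nc[OF B' B(1), of "Top j" "Top i" "Bot i" "Bot j"] B \<open>i \<le> n\<close> by auto
      qed
      then show False using eq \<open>i \<noteq> j\<close> by auto
    qed
    then show ?thesis using eq by simp
  qed
  have cases: "(\<exists>A\<in>P. B = Top ` A) \<or> (\<exists>A\<in>P. B = Bot ` A) \<or> (\<exists>t. B = {Top t, Bot t})"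
    if B: "B \<in> \<epsilon>" for B
  proof (cases "\<exists>i j. Top i \<in> B \<and> Bot j \<in> B")
    case True then show ?thesis using transversal[OF B] by blast
  next
    case False
    have "B \<subseteq> range Top \<union> range Bot" using un B unfolding verts_def by blast
    then consider "B \<subseteq> range Top" | "B \<subseteq> range Bot" using False by blast
    then show ?thesis
    proof cases
      case 1
      then obtain A where "B = Top ` A" by (auto simp: subset_image_iff)
      then show ?thesis using B unfolding P_def top_blocks_def by blast
    next
      case 2
      then obtain A where A: "B = Bot ` A" by (auto simp: subset_image_iff)
      then have "Top ` A \<in> \<epsilon>" using swap[OF B] by (simp add: image_image)
      then show ?thesis using A unfolding P_def top_blocks_def by blast
    qed
  qed
  have top: "Top ` A \<in> \<epsilon>" if "A \<in> P" for A using that unfolding P_def top_blocks_def by simp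
  have bot: "Bot ` A \<in> \<epsilon>" if "A \<in> P" for A using swap[OF top[OF that]] by (simp add: image_image)
  \<comment> \<open>Each upper vertex lies in exactly one block, which is either an upper block or a
    vertical one; so the points missed by \<open>P\<close> are exactly the transversal ones.\<close>
  have uncovered: "t \<in> {1..n} - \<Union>P \<longleftrightarrow> {Top t, Bot t} \<in> \<epsilon>" for t
  proof
    assume t: "t \<in> {1..n} - \<Union>P"
    then have "Top t \<in> verts n" unfolding verts_def by blast
    then obtain B where B: "B \<in> \<epsilon>" "Top t \<in> B" using un by blast
    then show "{Top t, Bot t} \<in> \<epsilon>" using cases[OF B(1)] t by auto
  next
    assume t: "{Top t, Bot t} \<in> \<epsilon>"
    have "t \<notin> A" if "A \<in> P" for A
    proof
      assume "t \<in> A"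
      then have "Top ` A = {Top t, Bot t}" using disj[OF top[OF that] t, of "Top t"] by blast
      then show False by (auto simp: set_eq_iff)
    qed
    then show "t \<in> {1..n} - \<Union>P" using bounds[OF t, of t] by auto
  qed
  show eq: "\<epsilon> = symmetric_diagram n P"
  proof (intro equalityI subsetI)
    fix B assume B: "B \<in> \<epsilon>"
    from cases[OF this] consider A where "A \<in> P" "B = Top ` A" | A where "A \<in> P" "B = Bot ` A"
      | t where "B = {Top t, Bot t}"
      by blast
    then show "B \<in> symmetric_diagram n P"
    proof cases
      case (3 t)
      then have "t \<in> {1..n} - \<Union>P" using uncovered B by simp
      then show ?thesis unfolding symmetric_diagram_def 3 by blast
    qed (simp_all add: symmetric_diagram_def)
  next
    fix B assume "B \<in> symmetric_diagram n P"
    then show "B \<in> \<epsilon>"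
    proof (cases rule: symmetric_diagram_cases)
      case (transversal t)
      then show ?thesis using uncovered[of t] by simp
    qed (use top bot in simp_all)
  qed
  show "P \<in> open_matchings n (diagram_rank \<epsilon>)"
    unfolding open_matchings_iff
  proof (intro conjI ballI impI)
    show "{} \<notin> P" using ne top by force
  next
    fix A B assume AB: "A \<in> P" "B \<in> P" "A \<noteq> B"
    have "inj Top" by (auto intro: injI)
    show "A \<inter> B = {}"
    proof (rule ccontr)
      assume "A \<inter> B \<noteq> {}"
      then obtain x where "x \<in> A" "x \<in> B" by blast
      then have "Top ` A = Top ` B" using disj top AB by blast
      then show False using AB(3) inj_image_eq_iff[OF \<open>inj Top\<close>] by blast
    qed
  next
    fix A assume A: "A \<in> P"
    show "A \<subseteq> {1..n}" using bounds[OF top[OF A]] by auto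
    have "card (Top ` A) = card A" by (rule card_image) (auto intro: inj_onI)
    then show "card A \<le> 2" using le2[OF top[OF A]] by simp
  next
    show "noncrossing id P"
    proof (rule noncrossingI)
      fix A B a b c d
      assume *: "A \<in> P" "B \<in> P" "a \<in> A" "b \<in> B" "c \<in> A" "d \<in> B"
        "id a < id b" "id b < id c" "id c < id d"
      have "inj Top" by (auto intro: injI)
      moreover have "Top ` A = Top ` B"
        by (rule nc[OF top top, of A B "Top a" "Top b" "Top c" "Top d"]) (use * in auto)
      ultimately show "A = B" by (simp add: inj_image_eq_iff)
    qed
  next
    fix A a c assume A: "A \<in> P" "a \<in> A" "c \<in> A"
    show "{a<..<c} \<subseteq> \<Union>P"
    proof (rule subsetI, rule ccontr)
      fix t assume t: "t \<in> {a<..<c}" "t \<notin> \<Union>P"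
      have "c \<le> n" using bounds[OF top[OF A(1)]] A by blast
      then have "t \<in> {1..n} - \<Union>P" using t by auto
      then have tB: "{Top t, Bot t} \<in> \<epsilon>" using uncovered by simp
      \<comment> \<open>The boundary order is \<open>Top a\<close>, \<open>Top t\<close>,
        \<open>Top c\<close>, \<open>Bot t\<close>, so an uncovered \<open>t\<close> below an arc
        would give a vertical block crossing that arc.\<close>
      have "Top ` A = {Top t, Bot t}"
        by (rule nc[OF top[OF A(1)] tB, of "Top a" "Top t" "Top c" "Bot t"])
          (use A t \<open>c \<le> n\<close> in auto)
      then show False by (auto simp: set_eq_iff)
    qed
  next
    show "card ({1..n} - \<Union>P) = diagram_rank \<epsilon>"
      using diagram_rank_symmetric_diagram[of n P] eq by simp
  qed
qed

section \<open>Counting the projections\<close>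

text \<open>\<open>symmetric_diagram n\<close> and \<open>top_blocks\<close> are mutually inverse,
  and rank corresponds to the number of uncovered points. That number is determined by
  \<open>P\<close>, so the classes for different \<open>r\<close> are disjoint and their sizes add
  up.\<close>

lemma card_Q_motzkin: "card (Q_motzkin n) = (\<Sum>r\<le>2. card (open_matchings n r))"
proof -
  have "bij_betw (symmetric_diagram n) (\<Union>r\<le>2. open_matchings n r) (Q_motzkin n)"
  proof (rule bij_betw_byWitness[where f' = top_blocks])
    show "\<forall>P\<in>\<Union>r\<le>2. open_matchings n r. top_blocks (symmetric_diagram n P) = P"
      by (auto simp: open_matchings_iff top_blocks_symmetric_diagram)
    show "\<forall>\<epsilon>\<in>Q_motzkin n. symmetric_diagram n (top_blocks \<epsilon>) = \<epsilon>"
      using star_symmetric_motzkin_diagram(2) unfolding Q_motzkin_def is_projection_def by auto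
    show "top_blocks ` Q_motzkin n \<subseteq> (\<Union>r\<le>2. open_matchings n r)"
      using star_symmetric_motzkin_diagram(1) unfolding Q_motzkin_def is_projection_def by blast
    show "symmetric_diagram n ` (\<Union>r\<le>2. open_matchings n r) \<subseteq> Q_motzkin n"
    proof (intro image_subsetI, elim UN_E)
      fix P r assume r: "r \<in> {..2::nat}" and P: "P \<in> open_matchings n r"
      then have "partition_on (\<Union>P) P" "\<Union>P \<subseteq> {1..n}" "card ({1..n} - \<Union>P) = r"
        unfolding open_matchings_def by blast+
      then show "symmetric_diagram n P \<in> Q_motzkin n"
        unfolding Q_motzkin_def is_projection_def
        using r symmetric_diagram_in_motzkin_monoid[OF P] diagram_rank_symmetric_diagram
          diagram_star_symmetric_diagram diagram_mult_symmetric_diagram by simp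
    qed
  qed
  then have "card (Q_motzkin n) = card (\<Union>r\<le>2. open_matchings n r)"
    by (metis bij_betw_same_card)
  also have "\<dots> = (\<Sum>r\<le>2. card (open_matchings n r))"
    by (rule card_UN_disjoint) (auto simp: finite_open_matchings, auto simp: open_matchings_iff)
  finally show ?thesis .
qed

theorem proposition7p7:
  fixes n :: nat
  shows "int (card (Q_motzkin n)) = int (motzkin (n + 2)) - int (motzkin (n + 1))"
proof -
  \<comment> \<open>The recurrence at \<open>r = 0\<close> has no term for \<open>r - 1\<close>, so
    the difference of consecutive Motzkin numbers counts the matchings with one uncovered
    point.\<close>
  have "motzkin (n + 2) = motzkin (n + 1) + card (open_matchings (Suc n) 1)"
    using card_open_matchings_Suc[of "Suc n" 0] by (simp add: motzkin_eq_card_open_matchings)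
  moreover have "card (open_matchings (Suc n) 1) = card (Q_motzkin n)"
    using card_open_matchings_Suc[of n 1] by (simp add: card_Q_motzkin numeral_2_eq_2)
  ultimately show ?thesis by simp
qed

end
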